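(* Let $G$ be a nonempty Dots & Boxes position consisting of loops and long chains, and let $f(G)$ be the number of $4$-loops in $G$. Then $v(G)>2$ if and only if either $c(G)>2$, or else both of the following hold: (A) at least one of: (A1) $G$ has exactly one $3$-chain and $\mathrm{size}(G)\equiv 3 \pmod 4$; (A2) $G$ has no $3$-chains and $\mathrm{size}(G)\not\equiv 2\pmod 4$; (B) at least one of: (B1) $c(G)+4f(G)>2$ and $c(G)\equiv 3$, $-3$ or $4 \pmod 8$; (B2) $c(G)+4f(G)<2$ and $f(G)$ is even.
   Context: Positions. A (Dots & Boxes) position $G$ consisting of loops and long chains is a finite multiset of components, each of which is either a chain of some integer length $\ge 3$ (a "long chain", or just "chain") or a loop of some even integer length $\ge 4$. All components are unopened. An $N$-chain is written $N$ and an $N$-loop is written $N_\ell$; positions are written additively, and $G-C$ denotes $G$ with the component $C$ removed. $\mathrm{size}(G)$ is the sum of the lengths of the components (the number of unclaimed boxes); $\mathrm{size}(C)$ is the length of the component $C$. Play and value. In a nonempty position the player to move (the opener) must choose a component $C$ to open. The other player (the controller) then either gives up control, i.e. captures all boxes of $C$ and becomes the opener in $G-C$, or keeps control, i.e. captures all but $2$ boxes of $C$ if $C$ is a chain (all but $4$ if $C$ is a loop), the leftover boxes being captured by the opener, who is then again the opener in $G-C$. Each player maximizes the number of boxes he captures. The value $v(G)$ is the margin by which the controller outscores the opener in $G$ under optimal play, and $v(G;C)$ is this margin given that the opener has just opened $C$. So $v(\emptyset)=0$, $v(G)=\min_C v(G;C)$ over the components $C$ of a nonempty $G$, and $$v(G;C)=\max\{\mathrm{size}(C)-2k+v(G-C),\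 \mathrm{size}(C)-v(G-C)\}=(\mathrm{size}(C)-k)+|v(G-C)-k|,$$ with $k=2$ if $C$ is a chain and $k=4$ if $C$ is a loop. Controlled value. $c(G)=\mathrm{size}(G)-4(\text{number of chains})-8(\text{number of loops})+\mathrm{tb}(G)$, where the terminal bonus $\mathrm{tb}(G)$ is $0$ if $G$ is empty; $8$ if $G$ consists of one or more loops and nothing else; $6$ if $G$ consists of one or more loops and one or more $3$-chains and nothing else; and $4$ otherwise. *)

theory Defs
  imports Main "HOL-Library.Multiset" "HOL-Number_Theory.Cong"
begin

datatype component = Chain nat | Loop nat

primrec comp_size :: "component \<Rightarrow> nat" where
  "comp_size (Chain n) = n"
| "comp_size (Loop n) = n"

primrec is_chain :: "component \<Rightarrow> bool" where
  "is_chain (Chain n) = True"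
| "is_chain (Loop n) = False"

abbreviation is_loop :: "component \<Rightarrow> bool" where
  "is_loop C \<equiv> \<not> is_chain C"

primrec valid_component :: "component \<Rightarrow> bool" where
  "valid_component (Chain n) \<longleftrightarrow> n \<ge> 3"
| "valid_component (Loop n) \<longleftrightarrow> n \<ge> 4 \<and> even n"

type_synonym position = "component multiset"

definition loops_and_long_chains :: "position \<Rightarrow> bool" where
  "loops_and_long_chains G \<longleftrightarrow> (\<forall>C \<in># G. valid_component C)"

text \<open>The number of boxes; the library's \<open>size G\<close> is the number of components.\<close>
definition boxes :: "position \<Rightarrow> nat" where
  "boxes G = (\<Sum>C\<in>#G. comp_size C)"

text \<open>The number of boxes left to the opener by a controller who keeps control.\<close>
definition given_up :: "component \<Rightarrow> int" where
  "given_up C = (if is_chain C then 2 else 4)"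

text \<open>
  The controller's margin once \<open>C\<close> has been opened, where \<open>x\<close> is the value of the rest of
  the position. Keeping control scores \<open>comp_size C - given_up C\<close> boxes against
  \<open>given_up C\<close>; giving up control scores all of \<open>C\<close>, and the players then swap roles.
\<close>
definition controller_margin :: "component \<Rightarrow> int \<Rightarrow> int" where
  "controller_margin C x =
     max (int (comp_size C) - 2 * given_up C + x) (int (comp_size C) - x)"

function game_value :: "position \<Rightarrow> int" where
  "game_value G =
     (if G = {#} then 0
      else Min ((\<lambda>C. controller_margin C (game_value (G - {#C#}))) ` set_mset G))"
  by pat_completeness auto
termination
  by (relation "measure size") (auto simp: size_Diff1_less)

declare game_value.simps [simp del]

text \<open>The value \<open>v(G;C)\<close>, meant for \<open>C \<in># G\<close>.\<close>
definition opened_value :: "position \<Rightarrow> component \<Rightarrow> int" where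
  "opened_value G C = controller_margin C (game_value (G - {#C#}))"

lemma game_value_empty [simp]: "game_value {#} = 0"
  by (simp add: game_value.simps)

lemma game_value_nonempty:
  "G \<noteq> {#} \<Longrightarrow> game_value G = (MIN C\<in>set_mset G. opened_value G C)"
  by (subst game_value.simps) (simp add: opened_value_def)

lemma opened_value_abs:
  "opened_value G C =
     (int (comp_size C) - given_up C) + \<bar>game_value (G - {#C#}) - given_up C\<bar>"
  by (simp add: opened_value_def controller_margin_def)

definition terminal_bonus :: "position \<Rightarrow> int" where
  "terminal_bonus G =
     (if G = {#} then 0
      else if \<forall>C \<in># G. is_loop C then 8
      else if (\<exists>C \<in># G. is_loop C) \<and> Chain 3 \<in># G \<and> (\<forall>C \<in># G. is_loop C \<or> C = Chain 3) then 6
      else 4)"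

definition controlled_value :: "position \<Rightarrow> int" where
  "controlled_value G =
     int (boxes G) - 4 * int (size (filter_mset is_chain G))
       - 8 * int (size {#C \<in># G. is_loop C#}) + terminal_bonus G"

definition four_loops :: "position \<Rightarrow> nat" where
  "four_loops G = count G (Loop 4)"

definition three_chains :: "position \<Rightarrow> nat" where
  "three_chains G = count G (Chain 3)"

end

theory Submission
  imports Defs
begin

text \<open>
  Write $c$ for the controlled value of a position and $f$ for its number of 4-loops. The theorem
  follows from an exact formula for the value, \<open>predicted\<close> below.

  The controller can always secure $c$, and when $c \ge 2$ the opener can hold the controller to
  it, so $v = c$. When $c < 2$ there is always a short component to open, and
  $0 \le v \le 4$; since $v$ has the parity of the number of boxes, only a choice between few
  values remains. Opening a component in front of a rest of value $x$ yields $|x - 4|$ for a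
  4-loop, $1 + |x - 2|$ for a 3-chain, $2 + |x - 2|$ for a 4-chain and $2 + |x - 4|$ for a 6-loop;
  the other components yield at least 3.

  Without 3-chains, the opener plays out the 4-loops. Each of them reflects the value by
  $x \mapsto |x - 4|$ and raises $c$ by 4. If $c$ reaches 2 before the 4-loops run out, the value
  $c + 4j$ attained there is reflected $j$ times, so that $c$ modulo 8 decides. If the 4-loops run
  out first, the position that remains has value 2, 3 or 4 (a 6-loop is opened in it), so that the
  parity of $f$ decides between the large values 3, 4 and the small ones 1, 0. The value 2
  is a fixed point of the reflection; it occurs exactly for $2$ modulo 4 boxes.

  A 3-chain yields at most 2 as soon as the rest has value 1, 2 or 3. So a position with 3-chains
  and $c < 2$ can have a value above 2 only if removing one leaves the value 0 or 4. If that rest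
  still contains a 3-chain, its value is not 4, and a value 0 comes from a 4-loop in it; opening this
  loop first yields 1. So the 3-chain must be the only one, and the rest must have a multiple of 4 boxes.
  This is condition (A); the reflection argument gives condition (B).

  The proof of the formula is an induction over the position: no opening yields less than the
  formula (\<open>predicted_le_margin\<close>), and some opening attains it
  (\<open>good_opening_big\<close>, \<open>good_opening_small\<close>). The reflection step is
  \<open>four_loop_response\<close>, which rests on \<open>cond_B_flip\<close>.
\<close>

section \<open>The controlled value and its terminal bonus\<close>

text \<open>
  The margin of a controller who keeps control in every component: the part of the controlled
  value that is additive over the components.
\<close>
definition fully_controlled :: "position \<Rightarrow> int" where
  "fully_controlled G = (\<Sum>C\<in>#G. int (comp_size C) - 2 * given_up C)"

lemma fully_controlled_empty [simp]: "fully_controlled {#} = 0"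
  by (simp add: fully_controlled_def)

lemma fully_controlled_add [simp]:
  "fully_controlled (add_mset C G) = int (comp_size C) - 2 * given_up C + fully_controlled G"
  by (simp add: fully_controlled_def)

lemma fully_controlled_boxes:
  "fully_controlled G = int (boxes G) - 4 * int (size (filter_mset is_chain G))
    - 8 * int (size {#C \<in># G. is_loop C#})"
  by (induction G) (auto simp: boxes_def given_up_def)

lemma controlled_value_fully_controlled:
  "controlled_value G = fully_controlled G + terminal_bonus G"
  by (simp add: controlled_value_def fully_controlled_boxes)

text \<open>
  This turns the congruences on the number of boxes into congruences on an additive quantity.
\<close>
lemma boxes_mod_4: "int (boxes G) mod 4 = fully_controlled G mod 4"
proof -
  have "int (boxes G) = fully_controlled G + 4 * (int (size (filter_mset is_chain G))
      + 2 * int (size {#C \<in># G. is_loop C#}))"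
    by (simp add: fully_controlled_boxes)
  then show ?thesis
    by (simp only: mod_mult_self2)
qed

lemma boxes_cong:
  "[boxes G = n] (mod 4) \<longleftrightarrow> fully_controlled G mod 4 = int n mod 4"
proof -
  have "[boxes G = n] (mod 4) \<longleftrightarrow> [int (boxes G) = int n] (mod int 4)"
    by (simp only: cong_int_iff)
  also have "\<dots> \<longleftrightarrow> fully_controlled G mod 4 = int n mod 4"
    by (simp only: cong_def boxes_mod_4 of_nat_numeral)
  finally show ?thesis .
qed

lemma even_bonus: "even (terminal_bonus G)"
  by (simp add: terminal_bonus_def)

text \<open>
  The terminal bonus depends only on which of the three kinds loop, 3-chain and longer chain occur.
  In this form its change under adding a component is a propositional matter.
\<close>
definition has_loop :: "position \<Rightarrow> bool" where
  "has_loop G \<longleftrightarrow> (\<exists>C \<in># G. is_loop C)"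

definition has_longer_chain :: "position \<Rightarrow> bool" where
  "has_longer_chain G \<longleftrightarrow> (\<exists>C \<in># G. is_chain C \<and> C \<noteq> Chain 3)"

definition only_threes :: "position \<Rightarrow> bool" where
  "only_threes G \<longleftrightarrow> \<not> has_loop G \<and> \<not> has_longer_chain G"

lemma has_loop_simps [simp]:
  "\<not> has_loop {#}" "has_loop (add_mset C G) \<longleftrightarrow> is_loop C \<or> has_loop G"
  by (auto simp: has_loop_def)

lemma has_longer_chain_simps [simp]:
  "\<not> has_longer_chain {#}"
  "has_longer_chain (add_mset C G) \<longleftrightarrow> is_chain C \<and> C \<noteq> Chain 3 \<or> has_longer_chain G"
  by (auto simp: has_longer_chain_def)

lemma three_chains_simps [simp]:
  "three_chains {#} = 0"
  "three_chains (add_mset C G) = (if C = Chain 3 then 1 else 0) + three_chains G"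
  by (auto simp: three_chains_def)

lemma four_loops_simps [simp]:
  "four_loops {#} = 0"
  "four_loops (add_mset C G) = (if C = Loop 4 then 1 else 0) + four_loops G"
  by (auto simp: four_loops_def)

lemma four_loops_no_loop: "\<not> has_loop G \<Longrightarrow> four_loops G = 0"
  by (induction G) auto

lemma empty_iff:
  "G = {#} \<longleftrightarrow> \<not> has_loop G \<and> \<not> has_longer_chain G \<and> three_chains G = 0"
  by (cases G) auto

lemma terminal_bonus_cases:
  "terminal_bonus G =
    (if has_longer_chain G then 4
     else if three_chains G > 0 then (if has_loop G then 6 else 4)
     else if has_loop G then 8 else 0)"
proof -
  have "(\<forall>C \<in># G. is_loop C) \<longleftrightarrow> \<not> has_longer_chain G \<and> three_chains G = 0"
    by (induction G) auto
  moreover have "(\<forall>C \<in># G. is_loop C \<or> C = Chain 3) \<longleftrightarrow> \<not> has_longer_chain G"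
    by (induction G) auto
  moreover have "Chain 3 \<in># G \<longleftrightarrow> three_chains G > 0"
    by (simp add: three_chains_def)
  ultimately show ?thesis
    unfolding terminal_bonus_def has_loop_def [symmetric] by (auto simp: empty_iff)
qed

lemma bonus_no_three:
  "G \<noteq> {#} \<Longrightarrow> three_chains G = 0 \<Longrightarrow> terminal_bonus G mod 4 = 0"
  by (auto simp: terminal_bonus_cases empty_iff)

text \<open>
  The controlled value of a position and of what is left after a loop is removed are compared all
  the time; the bonus interferes only if nothing or nothing but 3-chains is left.
\<close>
lemma bonus_add_loop:
  assumes "is_loop C" "H \<noteq> {#}" "\<not> only_threes H"
  shows "terminal_bonus (add_mset C H) = terminal_bonus H"
  using assms by (auto simp: terminal_bonus_cases only_threes_def empty_iff)

lemma bonus_only_threes: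
  "H \<noteq> {#} \<Longrightarrow> only_threes H \<Longrightarrow> terminal_bonus H = 4"
  by (auto simp: terminal_bonus_cases only_threes_def empty_iff)

lemma bonus_add_loop_only_threes:
  assumes "is_loop C" "H \<noteq> {#}" "only_threes H"
  shows "terminal_bonus (add_mset C H) = 6"
  using assms by (auto simp: terminal_bonus_cases only_threes_def empty_iff)

lemma fully_controlled_only_threes:
  "only_threes H \<Longrightarrow> fully_controlled H = - int (three_chains H)"
  by (induction H) (auto simp: only_threes_def given_up_def)

lemma bonus_add_chain_le:
  "is_chain C \<Longrightarrow> H \<noteq> {#} \<Longrightarrow> terminal_bonus (add_mset C H) \<le> terminal_bonus H"
  by (auto simp: terminal_bonus_cases empty_iff)

lemma bonus_add_three_ge:
  "H \<noteq> {#} \<Longrightarrow> terminal_bonus H \<le> terminal_bonus (add_mset (Chain 3) H) + 2"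
  by (auto simp: terminal_bonus_cases)

lemma bonus_singleton: "terminal_bonus {#C#} = 2 * given_up C"
  by (cases "C = Chain 3"; simp add: terminal_bonus_cases given_up_def)

section \<open>The value formula\<close>

definition cond_A :: "position \<Rightarrow> bool" where
  "cond_A G \<longleftrightarrow> three_chains G = 1 \<and> fully_controlled G mod 4 = 3 \<or>
    three_chains G = 0 \<and> fully_controlled G mod 4 \<noteq> 2"

definition cond_B :: "int \<Rightarrow> nat \<Rightarrow> bool" where
  "cond_B c f \<longleftrightarrow> c + 4 * int f > 2 \<and> (c mod 8 = 3 \<or> c mod 8 = 5 \<or> c mod 8 = 4)
     \<or> c + 4 * int f < 2 \<and> even f"

text \<open>
  A 4-loop in front of a rest of value 4 costs the opener nothing. For positions with 3-chains and
  $c < 2$ this is the only way to the value 0. It amounts to $c = 0$ and $f > 0$, except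
  for two 3-chains and one 4-loop, where removing the loop lowers the bonus.
\<close>
definition drop_to_4 :: "position \<Rightarrow> bool" where
  "drop_to_4 G \<longleftrightarrow> Loop 4 \<in># G \<and> controlled_value (G - {#Loop 4#}) = 4"

text \<open>
  Below $c = 2$ the parity leaves the values 1, 3 or 0, 2, 4, and (A) and (B) select the largest.
\<close>
definition predicted :: "position \<Rightarrow> int" where
  "predicted G = (let c = controlled_value G in
     if G = {#} then 0
     else if c \<ge> 2 then c
     else if cond_A G \<and> cond_B c (four_loops G) then (if odd c then 3 else 4)
     else if odd c then 1
     else if c mod 4 = 0 \<and> three_chains G = 0 \<or> drop_to_4 G then 0
     else 2)"

lemma predicted_empty [simp]: "predicted {#} = 0"
  by (simp add: predicted_def)

lemma controlled_value_empty [simp]: "controlled_value {#} = 0"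
  by (simp add: controlled_value_fully_controlled terminal_bonus_cases)

lemma predicted_eq_controlled_value:
  "controlled_value G \<ge> 2 \<Longrightarrow> predicted G = controlled_value G"
  by (cases "G = {#}") (simp_all add: predicted_def)

lemma odd_controlled_value:
  "odd (controlled_value G) \<longleftrightarrow> odd (fully_controlled G)"
  by (simp add: controlled_value_fully_controlled even_bonus)

lemma predicted_parity: "even (predicted G) \<longleftrightarrow> even (fully_controlled G)"
proof -
  have "even (predicted G) \<longleftrightarrow> even (controlled_value G)"
    by (cases "G = {#}") (simp_all add: predicted_def Let_def)
  then show ?thesis using odd_controlled_value by blast
qed

lemma predicted_nonneg: "predicted G \<ge> 0"
  by (simp add: predicted_def Let_def)

lemma controlled_value_le_predicted: "predicted G \<ge> controlled_value G"
proof (cases "controlled_value G \<ge> 2")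
  case False
  then have "controlled_value G = 1 \<or> controlled_value G \<le> 0" by linarith
  then show ?thesis
  proof
    assume "controlled_value G = 1"
    moreover from this have "G \<noteq> {#}" by auto
    ultimately show ?thesis by (simp add: predicted_def)
  qed (use predicted_nonneg [of G] in linarith)
qed (simp add: predicted_eq_controlled_value)

lemma predicted_le:
  "controlled_value G \<le> m \<Longrightarrow> m \<ge> 4 \<Longrightarrow> predicted G \<le> m"
  by (simp add: predicted_def Let_def)

lemma controlled_value_mod_4:
  assumes "G \<noteq> {#}" "three_chains G = 0"
  shows "controlled_value G mod 4 = fully_controlled G mod 4"
proof -
  have "4 dvd terminal_bonus G" using bonus_no_three [OF assms] by presburger
  then show ?thesis unfolding controlled_value_fully_controlled
    by (metis mod_add_right_eq dvd_imp_mod_0 add_0_right)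
qed

text \<open>
  Without 3-chains the bonus is a multiple of 4, so the number of boxes modulo 4 tells the value 2
  apart from the values 0 and 4.
\<close>
lemma predicted_mod_4:
  assumes "three_chains G = 0" "even (fully_controlled G)"
  shows "predicted G mod 4 = fully_controlled G mod 4"
proof (cases "G = {#}")
  case False
  have c: "controlled_value G mod 4 = fully_controlled G mod 4"
    using controlled_value_mod_4 [OF False assms(1)] .
  have "even (controlled_value G)"
    using assms(2) odd_controlled_value by blast
  moreover have "fully_controlled G mod 4 = 0 \<or> fully_controlled G mod 4 = 2"
    using assms(2) by presburger
  moreover have "\<not> drop_to_4 G" if "fully_controlled G mod 4 = 2"
  proof
    assume d: "drop_to_4 G"
    then obtain H where G: "G = add_mset (Loop 4) H"
      unfolding drop_to_4_def by (metis insert_DiffM)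
    then have "controlled_value H = 4" using d by (simp add: drop_to_4_def)
    moreover have "three_chains H = 0" using G assms(1) by simp
    moreover have "H \<noteq> {#}"
      using \<open>controlled_value H = 4\<close>
      by (auto simp: controlled_value_fully_controlled terminal_bonus_cases)
    ultimately have "fully_controlled H mod 4 = 0" using controlled_value_mod_4 [of H] by simp
    then have "fully_controlled G mod 4 = 0" using G by (simp add: given_up_def)
    then show False using that by simp
  qed
  ultimately show ?thesis
    using False c assms(1) by (elim disjE) (simp_all add: predicted_def Let_def cond_A_def)
qed simp

text \<open>
  The reflection in a 4-loop exchanges the values 0 and 4, and 1 and 3. Opening the loop passes from
  $(c, f + 1)$ to $(c + 4, f)$, which keeps $c + 4f$ fixed while it moves the residues
  3, 4, 5 modulo 8 to 7, 0, 1 and changes the parity of $f$.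
\<close>
lemma cond_B_flip:
  assumes "c mod 4 \<noteq> 2"
  shows "cond_B c (Suc f) \<longleftrightarrow> \<not> cond_B (c + 4) f"
proof -
  have "c + 4 * int (Suc f) \<noteq> 2"
    using assms by presburger
  moreover have "c mod 8 = 3 \<or> c mod 8 = 5 \<or> c mod 8 = 4 \<longleftrightarrow>
      \<not> ((c + 4) mod 8 = 3 \<or> (c + 4) mod 8 = 5 \<or> (c + 4) mod 8 = 4)"
  proof -
    define r where "r = c mod 8"
    have "0 \<le> r" "r < 8" by (simp_all add: r_def)
    then have "r = 0 \<or> r = 1 \<or> r = 2 \<or> r = 3 \<or> r = 4 \<or> r = 5 \<or> r = 6 \<or> r = 7"
      by linarith
    moreover have "(c + 4) mod 8 = (r + 4) mod 8"
      by (simp add: r_def mod_add_left_eq)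
    moreover have "c mod 4 = r mod 4"
      by (simp add: r_def mod_mod_cancel)
    ultimately show ?thesis
      using assms unfolding r_def [symmetric] by (elim disjE) simp_all
  qed
  moreover have "c + 4 * int (Suc f) = c + 4 + 4 * int f" by simp
  ultimately show ?thesis
    unfolding cond_B_def even_Suc by (elim linorder_neqE) simp_all
qed

lemma cond_B_small:
  assumes "-1 \<le> c" "c < 2"
  shows "\<not> cond_B c (Suc f)"
proof -
  have "c = -1 \<or> c = 0 \<or> c = 1" using assms by linarith
  then show ?thesis by (elim disjE) (simp_all add: cond_B_def)
qed

lemma cond_B_zero: "c < 2 \<Longrightarrow> cond_B c 0"
  by (simp add: cond_B_def)

lemma cond_A_mod:
  assumes "G \<noteq> {#}" "cond_A G"
  shows "controlled_value G mod 4 \<noteq> 2"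
proof (cases "three_chains G = 0")
  case True
  then show ?thesis using assms controlled_value_mod_4 by (simp add: cond_A_def)
next
  case False
  then have "odd (fully_controlled G)" using assms(2) unfolding cond_A_def by presburger
  then have "odd (controlled_value G)" by (simp add: odd_controlled_value)
  then show ?thesis by presburger
qed

text \<open>
  Under condition (A) the value is not 2, and opening a 4-loop reflects it: the rest has a small
  value if (B) holds, and one close to 4 if (B) fails. In the second case $c$ may have become at
  least 2, which accounts for the value 5.
\<close>
lemma four_loop_response:
  assumes "H \<noteq> {#}" "terminal_bonus (add_mset (Loop 4) H) = terminal_bonus H"
    and "controlled_value (add_mset (Loop 4) H) < 2" "cond_A (add_mset (Loop 4) H)"
  defines "b \<equiv> cond_B (controlled_value (add_mset (Loop 4) H)) (four_loops (add_mset (Loop 4) H))"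
  shows "b \<Longrightarrow> predicted H \<le> 1" "\<not> b \<Longrightarrow> 3 \<le> predicted H \<and> predicted H \<le> 5"
proof -
  let ?G = "add_mset (Loop 4) H" and ?c = "controlled_value (add_mset (Loop 4) H)"
  have c: "controlled_value H = ?c + 4"
    using assms(2) by (simp add: controlled_value_fully_controlled given_up_def)
  have A: "cond_A H"
    using assms(4) by (simp add: cond_A_def given_up_def)
  have m: "?c mod 4 \<noteq> 2"
    using cond_A_mod [OF _ assms(4)] by simp
  have f: "four_loops ?G = Suc (four_loops H)"
    by simp
  have "predicted H \<le> 1" if b
  proof -
    have s: "?c < -1"
      using that cond_B_small [of ?c "four_loops H"] assms(3) unfolding b_def f by linarith
    have "controlled_value H \<noteq> 2" using m c by presburger
    then have s: "controlled_value H < 2" using s c by linarith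
    have nB: "\<not> cond_B (controlled_value H) (four_loops H)"
      using that cond_B_flip [OF m] unfolding b_def f c by blast
    show ?thesis
    proof (cases "odd (controlled_value H)")
      case False
      then have "three_chains H = 0 \<and> controlled_value H mod 4 = 0"
        using A controlled_value_mod_4 [OF assms(1)] odd_controlled_value [of H]
          by (auto simp: cond_A_def) presburger+
      then show ?thesis using s nB assms(1) by (auto simp: predicted_def Let_def)
    qed (use s nB assms(1) in \<open>auto simp: predicted_def Let_def\<close>)
  qed
  then show "b \<Longrightarrow> predicted H \<le> 1" .
  have "3 \<le> predicted H \<and> predicted H \<le> 5" if "\<not> b"
  proof (cases "?c < -1")
    case True
    then have "cond_B (controlled_value H) (four_loops H)"
      using that cond_B_flip [OF m] unfolding b_def f c by blast
    moreover have "controlled_value H \<noteq> 2" using m c by presburger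
    then have "controlled_value H < 2" using True c by linarith
    ultimately show ?thesis using A assms(1) by (simp add: predicted_def Let_def)
  next
    case False
    then have "predicted H = ?c + 4" using c predicted_eq_controlled_value [of H] by simp
    then show ?thesis using False assms(3) by simp
  qed
  then show "\<not> b \<Longrightarrow> 3 \<le> predicted H \<and> predicted H \<le> 5" .
qed

section \<open>No opening yields less than the formula\<close>

definition margin :: "component \<Rightarrow> position \<Rightarrow> int" where
  "margin C H = int (comp_size C) - given_up C + \<bar>predicted H - given_up C\<bar>"

lemma margin_parity:
  "even (margin C H) \<longleftrightarrow> even (fully_controlled (add_mset C H))"
  by (simp add: margin_def predicted_parity given_up_def)

text \<open>
  The controller keeps control, unless $C$ is the last component or the last loop before a number
  of 3-chains: there the bonus shrinks, and giving up control can be better.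
\<close>
lemma predicted_le_margin_big:
  assumes "valid_component C" "controlled_value (add_mset C H) \<ge> 2"
  shows "margin C H \<ge> controlled_value (add_mset C H)"
proof (cases "H = {#}")
  case True
  then show ?thesis
    by (simp add: margin_def controlled_value_fully_controlled bonus_singleton given_up_def)
next
  case H: False
  show ?thesis
  proof (cases "is_loop C \<and> only_threes H")
    case True
    then have c: "controlled_value (add_mset C H) = int (comp_size C) - 2 - int (three_chains H)"
      "controlled_value H = 4 - int (three_chains H)"
      using H
        by (simp_all add: controlled_value_fully_controlled bonus_add_loop_only_threes fully_controlled_only_threes
          bonus_only_threes given_up_def)
    moreover have "three_chains H = 1 \<or> three_chains H \<ge> 2"
      using H True by (auto simp: only_threes_def empty_iff)
    ultimately show ?thesis
      using True predicted_eq_controlled_value [of H]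
        by (elim disjE) (simp_all add: margin_def given_up_def)
  next
    case False
    then have "terminal_bonus (add_mset C H) \<le> terminal_bonus H"
      using H bonus_add_chain_le [of C H] bonus_add_loop [of C H]
      by (cases "is_loop C") simp_all
    then show ?thesis
      using controlled_value_le_predicted [of H]
        by (auto simp: margin_def controlled_value_fully_controlled abs_if)
  qed
qed

text \<open>
  A margin below 3 would need a 3-chain before a value 1, 2 or 3, a 4-chain before the value 2, a
  6-loop before the value 4, or a 4-loop before a value strictly between 1 and 7. Conditions (A)
  and (B) exclude them: the number of boxes modulo 4 does so for the first three (together with
  parity), and the reflection step for the 4-loop.
\<close>
lemma margin_ge_3:
  assumes C: "valid_component C" and c: "controlled_value (add_mset C H) < 2"
    and A: "cond_A (add_mset C H)"
    and B: "cond_B (controlled_value (add_mset C H)) (four_loops (add_mset C H))"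
  shows "margin C H \<ge> 3"
proof (cases "H = {#}")
  case True
  then have False using C c
    by (cases C) (auto simp: controlled_value_fully_controlled bonus_singleton given_up_def)
  then show ?thesis ..
next
  case H: False
  show ?thesis
  proof (cases C)
    case (Chain n)
    consider "n = 3" | "n = 4" | "n \<ge> 5" using C Chain by fastforce
    then show ?thesis
    proof cases
      case 1
      then have "three_chains H = 0" "fully_controlled H mod 4 = 0"
        using A Chain by (auto simp: cond_A_def given_up_def) presburger+
      moreover from this have "even (fully_controlled H)" by presburger
      ultimately have "predicted H mod 4 = 0"
        using predicted_mod_4 by metis
      then show ?thesis using 1 Chain by (simp add: margin_def given_up_def) presburger
    next
      case 2
      show ?thesis
      proof (cases "even (fully_controlled H)")
        case True
        then have "three_chains H = 0" "fully_controlled H mod 4 = 0"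
          using A Chain 2 by (auto simp: cond_A_def given_up_def) presburger+
        then have "predicted H mod 4 = 0"
          using predicted_mod_4 True by metis
        then show ?thesis using 2 Chain by (simp add: margin_def given_up_def) presburger
      next
        case False
        then show ?thesis using 2 Chain predicted_parity [of H]
          by (simp add: margin_def given_up_def) presburger
      qed
    qed (use Chain in \<open>simp add: margin_def given_up_def\<close>)
  next
    case (Loop n)
    consider "n = 4" | "n = 6" | "n \<ge> 8" using C Loop by fastforce
    then show ?thesis
    proof cases
      case 1
      have "\<not> only_threes H"
      proof
        assume t: "only_threes H"
        have "three_chains H \<noteq> 0"
          using t H by (simp add: only_threes_def empty_iff)
        then have "three_chains H = 1"
          using A 1 Loop by (auto simp: cond_A_def)
        moreover have "four_loops H = 0" using t by (simp add: only_threes_def four_loops_no_loop)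
        ultimately have "\<not> cond_B (controlled_value (add_mset C H)) (four_loops (add_mset C H))"
          using t H 1 Loop
            by (simp add: controlled_value_fully_controlled bonus_add_loop_only_threes
             fully_controlled_only_threes given_up_def cond_B_def )
        then show False using B by blast
      qed
      then have "predicted H \<le> 1"
        using four_loop_response(1) [of H] H A B c 1 Loop bonus_add_loop [of "Loop 4" H] by simp
      then show ?thesis using 1 Loop by (simp add: margin_def given_up_def)
    next
      case 2
      show ?thesis
      proof (cases "even (fully_controlled H)")
        case True
        then have "three_chains H = 0" "fully_controlled H mod 4 = 2"
          using A Loop 2 by (auto simp: cond_A_def given_up_def) presburger+
        then have "predicted H mod 4 = 2"
          using predicted_mod_4 True by metis
        then show ?thesis using 2 Loop by (simp add: margin_def given_up_def) presburger
      next
        case False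
        then show ?thesis using 2 Loop predicted_parity [of H]
          by (simp add: margin_def given_up_def) presburger
      qed
    qed (use Loop in \<open>simp add: margin_def given_up_def\<close>)
  qed
qed

text \<open>
  Used for the only opening that could undercut the value 2: a 4-loop before the value 4.
\<close>
lemma predicted_eq_4:
  assumes "predicted H = 4"
  shows "controlled_value H = 4 \<or> three_chains H = 0 \<and> fully_controlled H mod 4 = 0 \<and> H \<noteq> {#}"
  using assms odd_controlled_value [of H]
    by (auto simp: predicted_def Let_def cond_A_def split: if_splits) presburger+

lemma predicted_le_margin:
  assumes "valid_component C"
  shows "predicted (add_mset C H) \<le> margin C H"
proof -
  let ?G = "add_mset C H" let ?c = "controlled_value ?G"
  have nn: "margin C H \<ge> 0"
    using assms by (cases C) (auto simp: margin_def given_up_def)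
  consider "?c \<ge> 2" | "?c < 2" "cond_A ?G \<and> cond_B ?c (four_loops ?G)" |
    "?c < 2" "\<not> (cond_A ?G \<and> cond_B ?c (four_loops ?G))"
    by linarith
  then show ?thesis
  proof cases
    case 1
    then show ?thesis using predicted_le_margin_big assms predicted_eq_controlled_value by simp
  next
    case 2
    then have "margin C H \<ge> 3" "predicted ?G \<le> 4"
      using margin_ge_3 [of C H] assms predicted_le [of ?G 4] by simp_all
    then show ?thesis using margin_parity [of C H] predicted_parity [of ?G] by presburger
  next
    case 3
    then have le: "predicted ?G \<le> 2"
      by (simp add: predicted_def Let_def)
    show ?thesis
    proof (rule ccontr)
      assume less: "\<not> ?thesis"
      \<comment> \<open>By parity an undercut margin is 0, which only a 4-loop before the value 4 yields.\<close>
      have m: "margin C H = 0" and p: "predicted ?G = 2"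
        using less nn le margin_parity [of C H] predicted_parity [of ?G] by presburger+
      then have C: "C = Loop 4" and x: "predicted H = 4"
        using assms by (cases C; force simp: margin_def given_up_def)+
      have even: "even ?c"
        using predicted_parity [of ?G] p odd_controlled_value [of ?G] by simp
      then have "\<not> drop_to_4 ?G" and nz: "\<not> (?c mod 4 = 0 \<and> three_chains ?G = 0)"
        using p 3 by (auto simp: predicted_def Let_def split: if_splits)
      then have "controlled_value H \<noteq> 4"
        using C by (simp add: drop_to_4_def)
      then have "three_chains ?G = 0" "fully_controlled ?G mod 4 = 0"
        using predicted_eq_4 [OF x] C by (auto simp: given_up_def)
      then show False using nz controlled_value_mod_4 [of ?G] by simp
    qed
  qed
qed

section \<open>Some opening attains the formula\<close>

lemma three_chainE:
  assumes "three_chains G > 0"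
  obtains H where "G = add_mset (Chain 3) H"
  using assms by (auto simp: three_chains_def dest: multi_member_split)

lemma four_loopE:
  assumes "four_loops G > 0"
  obtains H where "G = add_mset (Loop 4) H"
  using assms by (auto simp: four_loops_def dest: multi_member_split)

text \<open>
  Apart from 3-chains, only 4-loops and 6-loops contribute negatively.
\<close>
lemma fully_controlled_bound:
  assumes "loops_and_long_chains G" "four_loops G = 0" "Loop 6 \<notin># G"
  shows "fully_controlled G \<ge> - int (three_chains G)"
  using assms
proof (induction G)
  case (add C G)
  then have IH: "fully_controlled G \<ge> - int (three_chains G)" and C: "valid_component C"
    by (auto simp: loops_and_long_chains_def split: if_splits)
  show ?case
  proof (cases C)
    case (Chain n)
    then show ?thesis using IH C by (cases "n = 3") (auto simp: given_up_def)
  next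
    case (Loop n)
    then have "n \<noteq> 4" "n \<noteq> 6" "even n" "n \<ge> 4"
      using add.prems C by (auto split: if_splits)
    then have "n \<ge> 8" by presburger
    then show ?thesis using IH Loop by (simp add: given_up_def)
  qed
qed simp

lemma not_only_threes:
  "H \<noteq> {#} \<Longrightarrow> three_chains H = 0 \<Longrightarrow> \<not> only_threes H"
  by (simp add: only_threes_def empty_iff)

lemma bonus_ge: "H \<noteq> {#} \<Longrightarrow> terminal_bonus H \<ge> 4"
  by (auto simp: terminal_bonus_cases empty_iff)

text \<open>
  To hold the controller to $c$, the opener leaves a rest of value at least 2 after a chain and at
  least 4 after a loop, so that keeping control is a best reply, and preserves the bonus. Short
  components raise $c$ or lower it little, so they are opened early. A 3-chain is kept only if it is
  the sole chain among loops, since removing it would raise the bonus from 6 to 8; then, and without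
  3-chains, the order is 4-loops, 6-loops, other loops, chains.
\<close>
lemma good_opening_big:
  assumes G: "loops_and_long_chains G" "G \<noteq> {#}" and c: "controlled_value G \<ge> 2"
  obtains C H where "G = add_mset C H" "margin C H \<le> controlled_value G"
proof -
  \<comment> \<open>With 3-chains present, this says that removing one leaves the bonus unchanged
    or leaves nothing.\<close>
  let ?safe = "three_chains G \<ge> 2 \<or> has_longer_chain G \<or> \<not> has_loop G"
  consider (three) "three_chains G > 0" "?safe"
    | (four) "\<not> (three_chains G > 0 \<and> ?safe)" "four_loops G \<noteq> 0"
    | (six) "\<not> (three_chains G > 0 \<and> ?safe)" "Loop 6 \<in># G"
    | (loop) "\<not> (three_chains G > 0 \<and> ?safe)" "four_loops G = 0" "Loop 6 \<notin># G" "has_loop G"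
    | (chain) "\<not> (three_chains G > 0 \<and> ?safe)" "four_loops G = 0" "\<not> has_loop G"
    by metis
  then show thesis
  proof cases
    case three
    then obtain H where H: "G = add_mset (Chain 3) H" using three_chainE by blast
    have "margin (Chain 3) H \<le> controlled_value G"
    proof (cases "H = {#}")
      case True
      then show ?thesis
        using H
        by (simp add: margin_def controlled_value_fully_controlled bonus_singleton given_up_def)
    next
      case False
      then have "terminal_bonus G = terminal_bonus H"
        using three H by (auto simp: terminal_bonus_cases empty_iff)
      then have "controlled_value H = controlled_value G + 1"
        using H by (simp add: controlled_value_fully_controlled given_up_def)
      then show ?thesis
        using c predicted_eq_controlled_value [of H]
        by (simp add: margin_def given_up_def)
    qed
    then show ?thesis using that H by blast
  next
    case four
    then obtain H where H: "G = add_mset (Loop 4) H" by (auto elim: four_loopE)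
    have "margin (Loop 4) H \<le> controlled_value G"
    proof (cases "H = {#}")
      case True
      then show ?thesis
        using H
        by (simp add: margin_def controlled_value_fully_controlled bonus_singleton given_up_def)
    next
      case False
      have "\<not> only_threes H"
      proof
        assume t: "only_threes H"
        then have "three_chains H > 0" using False by (simp add: only_threes_def empty_iff)
        then show False using t False H c
         
            by (simp add: controlled_value_fully_controlled bonus_add_loop_only_threes fully_controlled_only_threes given_up_def)
      qed
      then have "controlled_value H = controlled_value G + 4"
        using H False bonus_add_loop [of "Loop 4" H]
          by (simp add: controlled_value_fully_controlled given_up_def)
      then show ?thesis
        using c predicted_eq_controlled_value [of H]
        by (simp add: margin_def given_up_def)
    qed
    then show ?thesis using that H by blast
  next
    case six
    then obtain H where H: "G = add_mset (Loop 6) H" by (auto dest: multi_member_split)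
    have "margin (Loop 6) H \<le> controlled_value G"
    proof (cases "H = {#}")
      case True
      then show ?thesis
        using H
        by (simp add: margin_def controlled_value_fully_controlled bonus_singleton given_up_def)
    next
      case False
      show ?thesis
      proof (cases "only_threes H")
        case True
        then have "three_chains H = 1"
          using six False H by (auto simp: only_threes_def empty_iff)
        then show ?thesis using True False H predicted_eq_controlled_value [of H]
         
            by (simp add: margin_def controlled_value_fully_controlled bonus_add_loop_only_threes bonus_only_threes
              fully_controlled_only_threes given_up_def)
      next
        case 3: False
        then have "controlled_value H = controlled_value G + 2"
          using H False bonus_add_loop [of "Loop 6" H]
            by (simp add: controlled_value_fully_controlled given_up_def)
        then show ?thesis
          using c predicted_eq_controlled_value [of H]
          by (simp add: margin_def given_up_def)
      qed
    qed
    then show ?thesis using that H by blast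
  next
    case loop
    then obtain C where "C \<in># G" and C: "is_loop C" by (auto simp: has_loop_def)
    then obtain H where H: "G = add_mset C H" by (auto dest: multi_member_split)
    then obtain n where n: "C = Loop n" using C by (cases C) auto
    have vH: "loops_and_long_chains H" "four_loops H = 0" "Loop 6 \<notin># H"
      using G loop H by (auto simp: loops_and_long_chains_def)
    have "margin C H \<le> controlled_value G"
    proof (cases "H = {#}")
      case True
      then show ?thesis
        using H n
        by (simp add: margin_def controlled_value_fully_controlled bonus_singleton given_up_def)
    next
      case False
      show ?thesis
      proof (cases "only_threes H")
        case True
        then have "three_chains H = 1"
          using loop False H n by (auto simp: only_threes_def empty_iff)
        then show ?thesis using True False H n predicted_eq_controlled_value [of H]
         
            by (simp add: margin_def controlled_value_fully_controlled bonus_add_loop_only_threes bonus_only_threes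
              fully_controlled_only_threes given_up_def)
      next
        case 3: False
        then have t: "terminal_bonus G = terminal_bonus H"
          using H False C bonus_add_loop [of C H] by simp
        have "three_chains H = 0 \<or> three_chains H = 1 \<and> terminal_bonus H = 6"
          using loop H n 3 by (auto simp: terminal_bonus_cases only_threes_def)
        then have "controlled_value H \<ge> 4"
          using fully_controlled_bound [OF vH] bonus_ge [OF False]
            by (auto simp: controlled_value_fully_controlled)
        then show ?thesis
          using t H n predicted_eq_controlled_value [of H]
            by (simp add: margin_def controlled_value_fully_controlled given_up_def)
      qed
    qed
    then show ?thesis using that H by blast
  next
    case chain
    then have no3: "three_chains G = 0" by simp
    then have "has_longer_chain G" using G(2) chain by (simp add: empty_iff)
    then obtain C where "C \<in># G" and C: "is_chain C" by (auto simp: has_longer_chain_def)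
    then obtain H where H: "G = add_mset C H" by (auto dest: multi_member_split)
    have vH: "loops_and_long_chains H" "four_loops H = 0" "Loop 6 \<notin># H"
      using G chain H by (auto simp: loops_and_long_chains_def has_loop_def)
    have "margin C H \<le> controlled_value G"
    proof (cases "H = {#}")
      case True
      then show ?thesis
        using H C
        by (simp add: margin_def controlled_value_fully_controlled bonus_singleton given_up_def)
    next
      case False
      then have "terminal_bonus H = 4" "terminal_bonus G = 4"
        using no3 chain H G(2) by (auto simp: terminal_bonus_cases empty_iff)
      moreover have "fully_controlled H \<ge> 0" using fully_controlled_bound [OF vH] no3 H by simp
      ultimately show ?thesis
        using H C predicted_eq_controlled_value [of H]
          by (simp add: margin_def controlled_value_fully_controlled given_up_def)
    qed
    then show ?thesis using that H by blast
  qed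
qed

text \<open>
  Under (A) without a 3-chain, the opener plays a 4-loop if there is one and a 6-loop otherwise; if
  (A) holds with a 3-chain, that chain is opened under (B), and a 4-loop if (B) fails.
  When (A) fails, a 4-loop before the value 4 comes first. Otherwise the value is 1 or 2: with
  3-chains around, one of them is opened, or rarely a 4-loop; without 3-chains the number of boxes
  is 2 modulo 4, and a 4-loop or 6-loop keeps the value at 2.
\<close>
lemma good_opening_small:
  assumes G: "loops_and_long_chains G" "G \<noteq> {#}" and c: "controlled_value G < 2"
  obtains C H where "G = add_mset C H" "margin C H \<le> predicted G"
proof -
  let ?A = "cond_A G" and ?B = "cond_B (controlled_value G) (four_loops G)"
  \<comment> \<open>A single component has its length as controlled value, hence at least 3.\<close>
  have ne: "H \<noteq> {#}" if "G = add_mset C H" for C H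
    using that G(1) c by (cases C)
      (auto simp: controlled_value_fully_controlled bonus_singleton given_up_def loops_and_long_chains_def)
  have par: "even (margin C H) \<longleftrightarrow> even (predicted G)" if "G = add_mset C H" for C H
    using that margin_parity predicted_parity by simp
  have c3: "controlled_value H \<le> 4" if "G = add_mset (Chain 3) H" for H
    using that c bonus_add_three_ge [OF ne [OF that]]
    by (simp add: controlled_value_fully_controlled given_up_def)
  \<comment> \<open>Without 4-loops and 6-loops, the bonus alone would give a controlled value of at least 4.\<close>
  have short: "four_loops G > 0 \<or> Loop 6 \<in># G" if "three_chains G = 0"
  proof (rule ccontr)
    assume "\<not> ?thesis"
    then have "fully_controlled G \<ge> 0" using fully_controlled_bound [OF G(1)] that by simp
    then show False using bonus_ge [OF G(2)] c by (simp add: controlled_value_fully_controlled)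
  qed
  have cloop: "controlled_value H = controlled_value G + 8 - int n"
    if "G = add_mset (Loop n) H" "\<not> only_threes H" for n H
    using that bonus_add_loop [OF _ ne [OF that(1)] that(2), of "Loop n"]
    by (simp add: controlled_value_fully_controlled given_up_def)
  have not3: "\<not> only_threes H" if "G = add_mset C H" "three_chains G = 0" for C H
    using that ne [OF that(1)] not_only_threes by simp
  consider (AB) "?A" "?B" | (A) "?A" "\<not> ?B" | (drop) "\<not> ?A" "drop_to_4 G"
    | (no3) "\<not> ?A" "\<not> drop_to_4 G" "three_chains G = 0"
    | (even3) "\<not> ?A" "\<not> drop_to_4 G" "three_chains G > 0" "even (fully_controlled G)"
    | (one3) "\<not> ?A" "three_chains G = 1" "odd (fully_controlled G)"
    | (many3) "\<not> ?A" "three_chains G \<ge> 2" "odd (fully_controlled G)"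
    by linarith
  then show thesis
  proof cases
    case AB
    then have p: "predicted G = (if odd (fully_controlled G) then 3 else 4)"
      using G(2) c by (simp add: predicted_def odd_controlled_value)
    have "three_chains G = 1 \<or> three_chains G = 0" using AB by (auto simp: cond_A_def)
    then show ?thesis
    proof
      assume "three_chains G = 1"
      then obtain H where H: "G = add_mset (Chain 3) H" using three_chainE [of G] by auto
      then have "predicted H \<le> 4" using c3 predicted_le [of H 4] by simp
      then have "margin (Chain 3) H \<le> 3"
        using predicted_nonneg [of H] by (simp add: margin_def given_up_def)
      then show ?thesis using that H p by fastforce
    next
      assume z: "three_chains G = 0"
      show ?thesis
      proof (cases "four_loops G > 0")
        case True
        then obtain H where H: "G = add_mset (Loop 4) H" using four_loopE by blast
        then have "predicted H \<le> 1"
          using four_loop_response(1) [OF ne [OF H]] not3 [OF H z] ne [OF H] AB c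
            bonus_add_loop [of "Loop 4" H] by simp
        then have "margin (Loop 4) H \<le> 4"
          using predicted_nonneg [of H] by (simp add: margin_def given_up_def)
        then have "margin (Loop 4) H \<le> predicted G"
          using par [OF H] p
          by (cases "margin (Loop 4) H = 4") (auto split: if_splits)
        then show ?thesis using that H by blast
      next
        case f: False
        then obtain H where H: "G = add_mset (Loop 6) H"
          using short [OF z] by (auto dest: multi_member_split)
        have cH: "controlled_value H = controlled_value G + 2"
          using cloop [OF H] not3 [OF H z] by simp
        have "margin (Loop 6) H \<le> predicted G"
        proof (cases "even (fully_controlled G)")
          case True
          moreover have "fully_controlled G mod 4 \<noteq> 2"
            using AB(1) z
            by (simp add: cond_A_def)
          ultimately have "fully_controlled G mod 4 = 0" by presburger
          then have "fully_controlled H mod 4 = 2" using H by (simp add: given_up_def) presburger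
          moreover from this have "even (fully_controlled H)" by presburger
          ultimately have "predicted H mod 4 = 2" using predicted_mod_4 [of H] z H by simp
          moreover have "predicted H \<le> 4" using cH c predicted_le [of H 4] by simp
          ultimately have "predicted H = 2" using predicted_nonneg [of H] by presburger
          then show ?thesis using p True by (simp add: margin_def given_up_def)
        next
          case False
          then have oH: "odd (fully_controlled H)" using H by (simp add: given_up_def)
          have "predicted H = 3"
          proof (cases "controlled_value H \<ge> 2")
            case True
            then show ?thesis
              using cH c oH odd_controlled_value [of H] predicted_eq_controlled_value [of H]
              by presburger
          next
            case 1: False
            have "cond_A H" using oH z H unfolding cond_A_def by simp presburger
            moreover have "cond_B (controlled_value H) (four_loops H)"
              using 1 f H cond_B_zero by simp
            ultimately show ?thesis
              using 1 oH ne [OF H] by (simp add: predicted_def odd_controlled_value)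
          qed
          then show ?thesis using p False by (simp add: margin_def given_up_def)
        qed
        then show ?thesis using that H by blast
      qed
    qed
  next
    case A
    then have "four_loops G > 0" using c cond_B_zero by (cases "four_loops G") auto
    then obtain H where H: "G = add_mset (Loop 4) H" using four_loopE by blast
    have "margin (Loop 4) H \<le> 1"
    proof (cases "only_threes H")
      case True
      then have "three_chains H = 1"
        using A(1) ne [OF H] H by (auto simp: cond_A_def only_threes_def empty_iff)
      then have "controlled_value H = 3"
        using True ne [OF H]
          by (simp add: controlled_value_fully_controlled bonus_only_threes fully_controlled_only_threes)
      then show ?thesis
        using predicted_eq_controlled_value [of H]
        by (simp add: margin_def given_up_def)
    next
      case False
      then have "3 \<le> predicted H \<and> predicted H \<le> 5"
        using four_loop_response(2) [OF ne [OF H]] ne [OF H] A c H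
          bonus_add_loop [of "Loop 4" H] by simp
      then show ?thesis by (auto simp: margin_def given_up_def)
    qed
    then have "margin (Loop 4) H \<le> predicted G"
      using par [OF H] predicted_nonneg [of G] by (cases "predicted G = 0") auto
    then show ?thesis using that H by blast
  next
    case drop
    then obtain H where H: "G = add_mset (Loop 4) H" "controlled_value H = 4"
      unfolding drop_to_4_def by (metis insert_DiffM)
    then have "margin (Loop 4) H = 0"
      using predicted_eq_controlled_value [of H]
      by (simp add: margin_def given_up_def)
    then show ?thesis using that H predicted_nonneg [of G] by metis
  next
    case no3
    then have m: "fully_controlled G mod 4 = 2" by (simp add: cond_A_def)
    then have e: "even (fully_controlled G)" by presburger
    have cm: "controlled_value G mod 4 = 2" using m controlled_value_mod_4 G(2) no3 by simp
    have p: "predicted G = 2"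
      using G(2) c no3 e cm by (simp add: predicted_def odd_controlled_value Let_def)
    show ?thesis
    proof (cases "four_loops G > 0")
      case True
      then obtain H where H: "G = add_mset (Loop 4) H" using four_loopE by blast
      then have "fully_controlled H mod 4 = 2" using m by (simp add: given_up_def)
      moreover from this have "even (fully_controlled H)" by presburger
      ultimately have x: "predicted H mod 4 = 2" using predicted_mod_4 [of H] no3 H by simp
      have "predicted H \<le> 6"
        using predicted_le [of H 6] cloop [OF H] not3 [OF H no3(3)] c by simp
      then have "predicted H = 2 \<or> predicted H = 6"
        using x predicted_nonneg [of H] by presburger
      then have "margin (Loop 4) H \<le> 2" by (auto simp: margin_def given_up_def)
      then show ?thesis using that H p by metis
    next
      case f: False
      then obtain H where H: "G = add_mset (Loop 6) H"
        using short [OF no3(3)] by (auto dest: multi_member_split)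
      have cH: "controlled_value H = controlled_value G + 2"
        using cloop [OF H] not3 [OF H no3(3)] by simp
      have "controlled_value G \<noteq> 1" "controlled_value G \<noteq> 0" using cm by auto
      then have small: "controlled_value H < 2" using cH c by linarith
      have "fully_controlled H mod 4 = 0" using m H by (simp add: given_up_def) presburger
      then have "cond_A H" "even (fully_controlled H)" using no3(3) H by (auto simp: cond_A_def)
      moreover have "cond_B (controlled_value H) (four_loops H)"
        using small f H cond_B_zero by simp
      ultimately have "predicted H = 4"
        using small ne [OF H] by (simp add: predicted_def odd_controlled_value)
      then have "margin (Loop 6) H \<le> 2" by (simp add: margin_def given_up_def)
      then show ?thesis using that H p by metis
    qed
  next
    case even3
    then have p: "predicted G = 2" using G(2) c by (simp add: predicted_def odd_controlled_value)
    obtain H where H: "G = add_mset (Chain 3) H" using even3 three_chainE by blast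
    have "predicted H \<le> 4" using c3 [OF H] predicted_le [of H 4] by simp
    then have "margin (Chain 3) H \<le> 3"
      using predicted_nonneg [of H] by (simp add: margin_def given_up_def)
    then have "margin (Chain 3) H \<le> 2"
      using par [OF H] p
      by (cases "margin (Chain 3) H = 3") auto
    then show ?thesis using that H p by metis
  next
    case one3
    then have p: "predicted G = 1" using G(2) c by (simp add: predicted_def odd_controlled_value)
    obtain H where H: "G = add_mset (Chain 3) H" using one3 three_chainE [of G] by auto
    have "fully_controlled G mod 4 = 1" using one3 unfolding cond_A_def by presburger
    then have "fully_controlled H mod 4 = 2" using H by (simp add: given_up_def) presburger
    moreover from this have "even (fully_controlled H)" by presburger
    ultimately have "predicted H mod 4 = 2" using predicted_mod_4 [of H] one3 H by simp
    moreover have "predicted H \<le> 4" using c3 [OF H] predicted_le [of H 4] by simp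
    ultimately have "predicted H = 2" using predicted_nonneg [of H] by presburger
    then have "margin (Chain 3) H \<le> 1" by (simp add: margin_def given_up_def)
    then show ?thesis using that H p by metis
  next
    case many3
    then have p: "predicted G = 1" using G(2) c by (simp add: predicted_def odd_controlled_value)
    obtain H where H: "G = add_mset (Chain 3) H" using many3 three_chainE [of G] by auto
    have t: "three_chains H > 0" using many3 H by simp
    have eH: "even (fully_controlled H)" using many3 H by (simp add: given_up_def)
    have cH: "controlled_value H = controlled_value G + 1"
      using t H by (simp add: controlled_value_fully_controlled terminal_bonus_cases given_up_def)
    show ?thesis
    \<comment> \<open>If removing the 3-chain would leave the value 0, the 4-loop responsible for that is opened
        instead: what is left then has value 3, and the margin is 1.\<close>
    proof (cases "drop_to_4 H")
      case True
      then obtain K where K: "H = add_mset (Loop 4) K" "controlled_value K = 4"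
        unfolding drop_to_4_def by (metis insert_DiffM)
      have "terminal_bonus (add_mset (Chain 3) K) = terminal_bonus K"
        using K t by (simp add: terminal_bonus_cases)
      then have "controlled_value (add_mset (Chain 3) K) = 3"
        using K by (simp add: controlled_value_fully_controlled given_up_def)
      then have "margin (Loop 4) (add_mset (Chain 3) K) = 1"
        using predicted_eq_controlled_value by (simp add: margin_def given_up_def)
      moreover have "G = add_mset (Loop 4) (add_mset (Chain 3) K)" using H K by simp
      ultimately show ?thesis using that p by (metis order_refl)
    next
      case False
      have "\<not> cond_A H" using eH t unfolding cond_A_def by presburger
      then have "predicted H = 2"
      proof (cases "controlled_value H \<ge> 2")
        case True
        then show ?thesis using cH c predicted_eq_controlled_value [of H] by simp
      qed (use False eH t ne [OF H] in \<open>simp add: predicted_def odd_controlled_value\<close>)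
      then have "margin (Chain 3) H \<le> 1" by (simp add: margin_def given_up_def)
      then show ?thesis using that H p by metis
    qed
  qed
qed

section \<open>The value of a position\<close>

lemma game_value_predicted:
  assumes "loops_and_long_chains G"
  shows "game_value G = predicted G"
  using assms
proof (induction "size G" arbitrary: G rule: less_induct)
  case less
  show ?case
  proof (cases "G = {#}")
    case False
    have opened: "opened_value G C = margin C H" if "G = add_mset C H" for C H
    proof -
      have "loops_and_long_chains H" using that less.prems by (simp add: loops_and_long_chains_def)
      then show ?thesis using that less.hyps [of H] by (simp add: opened_value_abs margin_def)
    qed
    have lo: "predicted G \<le> opened_value G C" if C: "C \<in># G" for C
    proof -
      obtain H where H: "G = add_mset C H" using C by (auto dest: multi_member_split)
      then show ?thesis
        using predicted_le_margin [of C H] opened [OF H] less.prems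
        by (simp add: loops_and_long_chains_def)
    qed
    obtain C H where H: "G = add_mset C H" and m: "margin C H \<le> predicted G"
    proof (cases "controlled_value G \<ge> 2")
      case True
      then show ?thesis
        using good_opening_big [OF less.prems False True] predicted_eq_controlled_value [OF True] that
        by metis
    next
      case c: False
      then show ?thesis using good_opening_small [OF less.prems False] that by (metis not_le)
    qed
    have C: "C \<in># G" using H by simp
    have "opened_value G C = predicted G" using opened [OF H] m lo [OF C] by simp
    then have "predicted G \<in> opened_value G ` set_mset G"
      using C by (metis imageI)
    then have "Min (opened_value G ` set_mset G) = predicted G"
      using lo by (intro Min_eqI) auto
    then show ?thesis using game_value_nonempty [OF False] by simp
  qed simp
qed

lemma predicted_gt_2:
  assumes "G \<noteq> {#}"
  shows "predicted G > 2 \<longleftrightarrow> controlled_value G > 2 \<or>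
    cond_A G \<and> cond_B (controlled_value G) (four_loops G)"
proof (cases "controlled_value G \<ge> 2")
  case True
  then consider "controlled_value G = 2" | "controlled_value G > 2" by linarith
  then show ?thesis
  proof cases
    case 1
    then show ?thesis using cond_A_mod [OF assms] predicted_eq_controlled_value [of G] by auto
  qed (use predicted_eq_controlled_value [of G] in simp)
qed (use assms in \<open>simp add: predicted_def Let_def\<close>)

theorem theorem1p4:
  fixes G :: position
  assumes "loops_and_long_chains G" and "G \<noteq> {#}"
  shows "game_value G > 2 \<longleftrightarrow>
    controlled_value G > 2 \<or>
    (((three_chains G = 1 \<and> [boxes G = 3] (mod 4)) \<or>
      (three_chains G = 0 \<and> \<not> [boxes G = 2] (mod 4))) \<and>
     ((controlled_value G + 4 * int (four_loops G) > 2 \<and>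
       ([controlled_value G = 3] (mod 8) \<or>
        [controlled_value G = -3] (mod 8) \<or>
        [controlled_value G = 4] (mod 8))) \<or>
      (controlled_value G + 4 * int (four_loops G) < 2 \<and> even (four_loops G))))"
proof -
  have "cond_A G \<longleftrightarrow> three_chains G = 1 \<and> [boxes G = 3] (mod 4) \<or>
      three_chains G = 0 \<and> \<not> [boxes G = 2] (mod 4)"
    by (simp add: cond_A_def boxes_cong)
  moreover have "cond_B (controlled_value G) (four_loops G) \<longleftrightarrow>
      controlled_value G + 4 * int (four_loops G) > 2 \<and>
        ([controlled_value G = 3] (mod 8) \<or> [controlled_value G = -3] (mod 8) \<or>
         [controlled_value G = 4] (mod 8)) \<or>
      controlled_value G + 4 * int (four_loops G) < 2 \<and> even (four_loops G)"
    by (simp add: cond_B_def cong_def)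
  ultimately show ?thesis
    using predicted_gt_2 [OF assms(2)] game_value_predicted [OF assms(1)] by simp
qed

end
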